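(* Let $n\ge1$, $m\ge1$. Perform a hyperoctahedral $2m$-shuffle on a deck of $n$ cards and then forget signs, obtaining a random permutation in $S_n$. The probability that this random permutation equals $w\in S_n$ is \[ \frac{4^{p(w^{-1})+1}}{2(2m)^n}\sum_{a=0}^{m-1}\binom{n+m-a-1}{n}\binom{n-1-2p(w^{-1})}{a-p(w^{-1})}, \] where $p(w^{-1})$ is the number of peaks of $w^{-1}$.
   Context: Signed permutations of $\{1,\dots,n\}$ form the hyperoctahedral group $B_n$; forgetting signs is the map $B_n\to S_n$ sending each entry to its absolute value. The hyperoctahedral $2m$-shuffle is the random element of $B_n$ described as follows: cut the deck into $2m$ piles according to a multinomial distribution (each card independently falls into each pile with probability $1/(2m)$), flip over (reverse and negate) the odd-numbered piles, and riffle the piles together by dropping one card at a time from one of the piles, each time choosing a pile with probability proportional to its current size. Equivalently, its inverse (in $B_n$) is distributed as follows: to each of $1,\dots,n$ assign independently and uniformly at random one of $-1,1,-2,2,\dots,-m,m$; then form the signed permutation (as a word) by listing the numbers assigned $-1$ in decreasing order with negative signs, then those assigned $1$ in increasing order with positive signs, then those assigned $-2$ in decreasing order with negative signs, then those assigned $2$ in increasing order with positive signs, and so on up to $m$. A peak of $\sigma\in S_n$ is an index $i$ with $1<i<n$ and $\sigma(i-1)<\sigma(i)>\sigma(i+1)$. Binomial coefficients $\binom{k}{j}$ are $0$ unless $0\le j\le k$. *)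

theory Defs
  imports "HOL-Probability.Probability" "HOL-Combinatorics.Permutations"
begin

text \<open>
  A deck is a list, top card first. The fresh deck is \<open>[1, \<dots>, n]\<close>; a card turned over carries
  a negative sign. A signed permutation is written as a word, so a deck reads off the signed
  permutation sending the position \<open>i\<close> to the card \<open>\<sigma> ! (i - 1)\<close>.
\<close>

definition signed_perms :: "nat \<Rightarrow> int list set" where
  "signed_perms n = {\<sigma>. length \<sigma> = n \<and> abs ` set \<sigma> = {1..int n}}"

definition forget_signs :: "int list \<Rightarrow> nat \<Rightarrow> nat" where
  "forget_signs \<sigma> i = (if i \<in> {1..length \<sigma>} then nat \<bar>\<sigma> ! (i - 1)\<bar> else i)"

text \<open>
  The multinomial vector of pile sizes: each of \<open>n\<close> cards independently receives a uniform pile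
  number in \<open>{1..r}\<close>, and only the number of cards per pile is kept.
\<close>

definition pile_sizes :: "nat \<Rightarrow> nat \<Rightarrow> nat list pmf" where
  "pile_sizes r n =
     map_pmf (\<lambda>ls. map (count_list ls) [1..<Suc r]) (replicate_pmf n (pmf_of_set {1..r}))"

fun cut_deck :: "nat list \<Rightarrow> 'a list \<Rightarrow> 'a list list" where
  "cut_deck [] xs = []"
| "cut_deck (j # js) xs = take j xs # cut_deck js (drop j xs)"

definition flip_pile :: "int list \<Rightarrow> int list" where
  "flip_pile p = map uminus (rev p)"

text \<open>Piles are numbered from 1, so the top pile is turned over.\<close>

definition flip_odd_piles :: "int list list \<Rightarrow> int list list" where
  "flip_odd_piles ps = map (\<lambda>(i, p). if odd i then flip_pile p else p) (List.enumerate 1 ps)"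

definition choose_pile :: "'a list list \<Rightarrow> nat pmf" where
  "choose_pile ps = pmf_of_multiset (\<Sum>i<length ps. replicate_mset (length (ps ! i)) i)"

text \<open>
  \<open>riffle k ps\<close> is meant for piles \<open>ps\<close> with \<open>k\<close> cards in total. Cards drop from the bottom of
  a pile, so the card dropped first ends up at the bottom of the resulting deck.
\<close>

primrec riffle :: "nat \<Rightarrow> 'a list list \<Rightarrow> 'a list pmf" where
  "riffle 0 ps = return_pmf []"
| "riffle (Suc k) ps =
     bind_pmf (choose_pile ps) (\<lambda>i.
       map_pmf (\<lambda>deck. deck @ [last (ps ! i)]) (riffle k (ps[i := butlast (ps ! i)])))"

definition hyperoctahedral_shuffle :: "nat \<Rightarrow> nat \<Rightarrow> int list pmf" where
  "hyperoctahedral_shuffle m n =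
     bind_pmf (pile_sizes (2 * m) n) (\<lambda>js.
       riffle n (flip_odd_piles (cut_deck js [1..int n])))"

lemma in_set_choose_pileD:
  assumes "concat ps \<noteq> []" and "i \<in> set_pmf (choose_pile ps)"
  shows "i < length ps \<and> ps ! i \<noteq> []"
proof -
  let ?M = "\<Sum>i<length ps. replicate_mset (length (ps ! i)) i"
  obtain p where p: "p \<in> set ps" "p \<noteq> []"
    using assms(1) by auto
  then obtain j where j: "j < length ps" "ps ! j \<noteq> []"
    by (metis in_set_conv_nth)
  have mem: "k \<in># ?M \<longleftrightarrow> k < length ps \<and> ps ! k \<noteq> []" for k
    by (auto simp: set_mset_sum)
  with j have "?M \<noteq> {#}"
    by (metis empty_iff set_mset_empty)
  then have "set_pmf (choose_pile ps) = set_mset ?M"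
    by (simp add: choose_pile_def)
  with mem assms(2) show ?thesis by blast
qed

lemma mset_riffle:
  assumes "deck \<in> set_pmf (riffle k ps)" and "length (concat ps) = k"
  shows "mset deck = mset (concat ps)"
  using assms
proof (induction k arbitrary: deck ps)
  case 0
  then show ?case by simp
next
  case (Suc k)
  then obtain i d where i: "i \<in> set_pmf (choose_pile ps)"
    and d: "d \<in> set_pmf (riffle k (ps[i := butlast (ps ! i)]))"
    and deck: "deck = d @ [last (ps ! i)]"
    by auto
  have ne: "concat ps \<noteq> []"
    using Suc.prems(2) by (metis length_0_conv nat.distinct(1))
  have i': "i < length ps" "ps ! i \<noteq> []"
    using in_set_choose_pileD[OF ne i] by auto
  have ps: "ps = take i ps @ (butlast (ps ! i) @ [last (ps ! i)]) # drop (Suc i) ps"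
    using i' by (simp add: id_take_nth_drop)
  have upd: "ps[i := butlast (ps ! i)] = take i ps @ butlast (ps ! i) # drop (Suc i) ps"
    using i' by (simp add: upd_conv_take_nth_drop)
  have eq: "mset (concat ps) = add_mset (last (ps ! i)) (mset (concat (ps[i := butlast (ps ! i)])))"
    by (subst ps, subst upd) simp
  have "length (concat (ps[i := butlast (ps ! i)])) = k"
    using arg_cong[OF eq, of size] Suc.prems(2) by (simp add: size_mset[symmetric] del: size_mset)
  from Suc.IH[OF d this] show ?case
    using eq deck by simp
qed

lemma concat_cut_deck: "sum_list js = length xs \<Longrightarrow> concat (cut_deck js xs) = xs"
  by (induction js arbitrary: xs) auto

lemma mset_abs_flip_odd_piles:
  "image_mset abs (mset (concat (flip_odd_piles ps))) = image_mset abs (mset (concat ps))"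
proof -
  have "image_mset abs (mset (concat (map (\<lambda>(i, p). if odd i then flip_pile p else p)
          (List.enumerate k ps)))) = image_mset abs (mset (concat ps))" for k
    by (induction ps arbitrary: k) (auto simp: flip_pile_def multiset.map_comp o_def)
  then show ?thesis by (simp add: flip_odd_piles_def)
qed

lemma sum_list_pile_sizes:
  assumes "js \<in> set_pmf (pile_sizes r n)" and "r \<ge> 1"
  shows "sum_list js = n"
proof -
  obtain ls where "ls \<in> set_pmf (replicate_pmf n (pmf_of_set {1..r}))"
    and js: "js = map (count_list ls) [1..<Suc r]"
    using assms(1) unfolding pile_sizes_def set_map_pmf by blast
  then have ls: "set ls \<subseteq> {1..r}" "length ls = n"
    using assms(2) by (auto simp: set_replicate_pmf in_lists_conv_set)
  have "sum_list js = (\<Sum>i\<in>{1..r}. count_list ls i)"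
    unfolding js by (simp only: sum_list_distinct_conv_sum_set[OF distinct_upt] set_upt
        atLeastLessThanSuc_atLeastAtMost)
  also have "\<dots> = (\<Sum>i\<in>set ls. count_list ls i)"
    using ls(1) by (intro sum.mono_neutral_right) (auto simp: count_list_0_iff)
  also have "\<dots> = n"
    using ls(2) by (simp add: sum_count_set)
  finally show ?thesis .
qed

lemma hyperoctahedral_shuffle_signed_perms:
  assumes "m \<ge> 1"
  shows "set_pmf (hyperoctahedral_shuffle m n) \<subseteq> signed_perms n"
proof
  fix \<sigma> assume "\<sigma> \<in> set_pmf (hyperoctahedral_shuffle m n)"
  then obtain js where js: "js \<in> set_pmf (pile_sizes (2 * m) n)"
    and \<sigma>: "\<sigma> \<in> set_pmf (riffle n (flip_odd_piles (cut_deck js [1..int n])))"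
    by (auto simp: hyperoctahedral_shuffle_def)
  let ?ps = "flip_odd_piles (cut_deck js [1..int n])"
  have "sum_list js = length [1..int n]"
    using sum_list_pile_sizes[OF js] assms by simp
  from concat_cut_deck[OF this]
  have abs: "image_mset abs (mset (concat ?ps)) = image_mset abs (mset [1..int n])"
    by (simp add: mset_abs_flip_odd_piles del: mset_concat)
  then have "length (concat ?ps) = n"
    by (metis diff_add_cancel length_upto nat_int size_image_mset size_mset)
  from mset_riffle[OF \<sigma> this] abs
  have eq: "image_mset abs (mset \<sigma>) = image_mset abs (mset [1..int n])"
    by simp
  have "length \<sigma> = n"
    using arg_cong[OF eq, of size] by simp
  moreover have "abs ` set \<sigma> = {1..int n}"
    using arg_cong[OF eq, of set_mset] by force
  ultimately show "\<sigma> \<in> signed_perms n"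
    by (simp add: signed_perms_def)
qed

definition num_peaks :: "nat \<Rightarrow> (nat \<Rightarrow> nat) \<Rightarrow> nat" where
  "num_peaks n \<sigma> = card {i. 1 < i \<and> i < n \<and> \<sigma> (i - 1) < \<sigma> i \<and> \<sigma> i > \<sigma> (i + 1)}"

text \<open>
  Integer arguments, because \<open>a - p\<close> may be negative in the theorem and truncated subtraction
  would then give a wrong nonzero coefficient.
\<close>

definition binom :: "int \<Rightarrow> int \<Rightarrow> nat" where
  "binom k j = (if 0 \<le> j \<and> j \<le> k then nat k choose nat j else 0)"

end

theory Submission
  imports Defs "HOL-Combinatorics.Multiset_Permutations"
begin

text \<open>
  Give every card the number of its pile. Given the pile sizes, every interleaving of the piles is
  equally likely, and the factorials cancel against the multinomial weights; so the probability of
  \<open>w\<close> is \<open>(2m)\<^bsup>-n\<^esup>\<close> times the number of weakly increasing label sequences \<open>s\<close> on the cards with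
  values in \<open>{1..2m}\<close> for which \<open>u = inv w\<close> (card to final position) decreases along the cards of
  each odd (turned) pile and increases along those of each even pile.

  Let \<open>X\<close>, \<open>Y\<close> be the generating functions in \<open>t\<close> of the numbers of such sequences on the first
  few cards whose last label is \<open>2j - 1\<close>, respectively \<open>2j\<close>, and put \<open>T = (X + Y) / (1 - t)\<close>.
  Appending a card turns \<open>(X, Y)\<close> into \<open>(tT, T)\<close> if \<open>u\<close> has an ascent there and into
  \<open>(tT + X, tT + X)\<close> if it has a descent. Hence \<open>T\<close> gets multiplied by \<open>(1 + t) / (1 - t)\<close>, except
  when a descent follows an ascent, that is, at a peak, where the factor is
  \<open>4t / ((1 - t)(1 + t))\<close>. This gives
  \<open>T = 2t (1 + t)\<^bsup>n-1-2p\<^esup> (4t)\<^bsup>p\<^esup> / (1 - t)\<^bsup>n+1\<^esup>\<close>, and the count is the coefficient of \<open>t\<^bsup>m\<^esup>\<close>.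
\<close>

section \<open>Riffling distinct cards\<close>

lemma pmf_choose_pile:
  assumes "concat ps \<noteq> []" and "i < length ps"
  shows "pmf (choose_pile ps) i = real (length (ps ! i)) / real (length (concat ps))"
proof -
  let ?M = "\<Sum>i<length ps. replicate_mset (length (ps ! i)) i"
  have cnt: "count ?M i = length (ps ! i)"
    using assms(2) by (simp add: count_sum)
  have size: "size ?M = length (concat ps)"
    by (simp add: size_multiset_sum length_concat sum_list_sum_nth atLeast0LessThan)
  have "0 < size ?M"
    unfolding size using assms(1) by (simp only: length_greater_0_conv not_False_eq_True)
  then have "?M \<noteq> {#}" by (simp only: nonempty_has_size)
  then show ?thesis
    unfolding choose_pile_def by (simp only: pmf_of_multiset[OF \<open>?M \<noteq> {#}\<close>] cnt size)
qed

lemma length_concat_update_butlast: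
  assumes "i < length ps" and "ps ! i \<noteq> []" and "length (concat ps) = Suc k"
  shows "length (concat (ps[i := butlast (ps ! i)])) = k"
proof -
  define x q where "x = last (ps ! i)" and "q = butlast (ps ! i)"
  have ps: "take i ps @ (q @ [x]) # drop (Suc i) ps = ps"
    using assms(1,2) by (simp add: x_def q_def id_take_nth_drop[symmetric])
  have "length (concat (take i ps @ (q @ [x]) # drop (Suc i) ps)) =
      Suc (length (concat (take i ps @ q # drop (Suc i) ps)))"
    by simp
  then show ?thesis
    unfolding ps using assms(1,3) by (simp only: q_def upd_conv_take_nth_drop)
qed

lemma choose_pile_map [simp]: "choose_pile (map (map f) ps) = choose_pile ps"
  by (simp add: choose_pile_def)

text \<open>Pile choices depend only on pile sizes, and a chosen pile is nonempty, so renaming cards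
  commutes with dropping them. With \<open>abs\<close> as the renaming, signs can be forgotten
  before the riffle.\<close>

lemma map_riffle:
  assumes "length (concat ps) = k"
  shows "map_pmf (map f) (riffle k ps) = riffle k (map (map f) ps)"
  using assms
proof (induction k arbitrary: ps)
  case (Suc k)
  then have ne: "concat ps \<noteq> []" by (metis list.size(3) nat.distinct(1))
  have "map_pmf (map f) (map_pmf (\<lambda>deck. deck @ [last (ps ! i)]) (riffle k (ps[i := butlast (ps ! i)]))) =
    map_pmf (\<lambda>deck. deck @ [last (map (map f) ps ! i)])
      (riffle k ((map (map f) ps)[i := butlast (map (map f) ps ! i)]))"
    if "i \<in> set_pmf (choose_pile ps)" for i
  proof -
    have i: "i < length ps" "ps ! i \<noteq> []" using in_set_choose_pileD[OF ne that] by auto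
    have e: "(map (map f) ps)[i := butlast (map (map f) ps ! i)] =
        map (map f) (ps[i := butlast (ps ! i)])"
      using i by (simp add: map_update map_butlast)
    have l: "last (map (map f) ps ! i) = f (last (ps ! i))"
      using i by (simp add: last_map)
    show ?thesis
      unfolding e l Suc.IH[OF length_concat_update_butlast[OF i Suc.prems], symmetric]
      by (simp add: pmf.map_comp o_def)
  qed
  then show ?case
    unfolding riffle.simps map_bind_pmf choose_pile_map by (intro bind_pmf_cong refl)
qed simp

section \<open>Interleavings of distinct cards and their uniform probability\<close>

text \<open>For piles with pairwise distinct cards this describes the interleavings: each pile can
  be recovered, in order, from the deck.\<close>

definition is_riffle :: "'a list list \<Rightarrow> 'a list \<Rightarrow> bool" where
  "is_riffle ps d \<longleftrightarrow> set d \<subseteq> set (concat ps) \<and>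
     (\<forall>i<length ps. filter (\<lambda>x. x \<in> set (ps ! i)) d = ps ! i)"

lemma distinct_concat_nth_disjoint:
  assumes "distinct (concat ps)" "i < length ps" "j < length ps" "i \<noteq> j"
  shows "set (ps ! i) \<inter> set (ps ! j) = {}"
  using assms
proof (induction i j rule: linorder_wlog)
  case (le i j)
  have "ps ! j = drop (Suc i) ps ! (j - Suc i)" "j - Suc i < length (drop (Suc i) ps)"
    using le by auto
  then have j: "ps ! j \<in> set (drop (Suc i) ps)" by (metis nth_mem)
  have "distinct (concat (take i ps @ ps ! i # drop (Suc i) ps))"
    using le by (simp add: id_take_nth_drop[symmetric])
  with j show ?case by auto
qed blast

text \<open>The card \<open>x\<close> lies in pile \<open>i\<close> only and occurs there once, so
  removing it from the bottom of the deck affects just the condition on that pile. This mirrors one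
  drop of the riffle.\<close>

lemma is_riffle_snoc:
  assumes d: "distinct (concat ps)" and i: "i < length ps" and psi: "ps ! i = q @ [x]"
  shows "is_riffle ps (d @ [x]) \<longleftrightarrow> is_riffle (ps[i := q]) d"
proof -
  have "distinct (ps ! i)" using d i by (simp add: distinct_concat_iff)
  then have dq: "distinct (q @ [x])" by (simp only: psi)
  have others: "x \<notin> set (ps ! j)" if "j < length ps" "j \<noteq> i" for j
    using distinct_concat_nth_disjoint[OF d i that(1)] that psi by auto
  have set1: "set (concat ps) = insert x (set (concat (ps[i := q])))"
    by (subst id_take_nth_drop[OF i]) (use i in \<open>auto simp: psi upd_conv_take_nth_drop\<close>)
  have set2: "x \<notin> set (concat (ps[i := q]))"
  proof
    assume "x \<in> set (concat (ps[i := q]))"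
    then obtain j where "j < length ps" "x \<in> set (ps[i := q] ! j)"
      by (force simp: in_set_conv_nth[of _ "ps[i := q]"])
    then show False using others dq i by (cases "j = i") auto
  qed
  show ?thesis
  proof
    assume L: "is_riffle ps (d @ [x])"
    then have "filter (\<lambda>y. y \<in> set (ps ! i)) (d @ [x]) = ps ! i" using i by (auto simp: is_riffle_def)
    then have f: "filter (\<lambda>y. y = x \<or> y \<in> set q) d = q" using psi by (simp add: disj_commute)
    have "x \<in> set (filter (\<lambda>y. y = x \<or> y \<in> set q) d)" if "x \<in> set d"
      using that by simp
    then have x: "x \<notin> set d" using dq unfolding f by auto
    have "filter (\<lambda>y. y \<in> set q) d = filter (\<lambda>y. y = x \<or> y \<in> set q) d"
      using x by (intro filter_cong) auto
    with f have "filter (\<lambda>y. y \<in> set q) d = q" by simp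
    then show "is_riffle (ps[i := q]) d"
      using L others x i set1 by (auto simp: is_riffle_def nth_list_update)
  next
    assume R: "is_riffle (ps[i := q]) d"
    then have x: "x \<notin> set d" using set2 by (auto simp: is_riffle_def)
    have f: "filter (\<lambda>y. y \<in> set q) d = q"
      using R i by (auto simp: is_riffle_def)
    have "filter (\<lambda>y. y = x \<or> y \<in> set q) d = filter (\<lambda>y. y \<in> set q) d"
      using x by (intro filter_cong) auto
    then have "filter (\<lambda>y. y \<in> set (ps ! i)) (d @ [x]) = ps ! i"
      using f psi by (simp add: disj_commute)
    moreover have "filter (\<lambda>y. y \<in> set (ps ! j)) (d @ [x]) = ps ! j" if "j < length ps" "j \<noteq> i" for j
      using R that others[OF that] by (auto simp: is_riffle_def)
    ultimately have "\<forall>j<length ps. filter (\<lambda>y. y \<in> set (ps ! j)) (d @ [x]) = ps ! j"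
      by blast
    moreover have "set (d @ [x]) \<subseteq> set (concat ps)"
      using R unfolding is_riffle_def set1 by auto
    ultimately show "is_riffle ps (d @ [x])"
      by (simp only: is_riffle_def)
  qed
qed

lemma pmf_map_snoc:
  "pmf (map_pmf (\<lambda>d. d @ [y]) M) (d @ [x]) = (if x = y then pmf M d else 0)"
proof (cases "x = y")
  case True
  then show ?thesis by (simp add: pmf_map_inj'[of "\<lambda>d. d @ [y]"] inj_def)
next
  case False
  then show ?thesis by (simp add: pmf_map_outside image_iff)
qed

text \<open>The bottom card of the deck identifies the pile it dropped from, so an interleaving
  arises from exactly one sequence of drops. Along it the denominators run through
  \<open>k, k - 1, ..., 1\<close>, while the numerators of each pile run from its length down to
  1.\<close>

lemma pmf_riffle:
  assumes "distinct (concat ps)" and "length (concat ps) = k"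
  shows "pmf (riffle k ps) d =
    (if is_riffle ps d then (\<Prod>p\<leftarrow>ps. fact (length p)) / fact k else 0)"
  using assms
proof (induction k arbitrary: ps d)
  case 0
  then have e: "concat ps = []" by simp
  then have "\<forall>i<length ps. ps ! i = []" by simp
  then have "is_riffle ps d \<longleftrightarrow> d = []"
    unfolding is_riffle_def e by auto
  moreover have "(\<Prod>p\<leftarrow>ps. fact (length p)) = (1 :: real)"
    using 0 by (induction ps) auto
  ultimately show ?case by (simp add: indicator_def)
next
  case (Suc k)
  then have ne: "concat ps \<noteq> []" by (metis list.size(3) nat.distinct(1))
  let ?R = "\<lambda>i. map_pmf (\<lambda>deck. deck @ [last (ps ! i)]) (riffle k (ps[i := butlast (ps ! i)]))"
  have sum: "pmf (riffle (Suc k) ps) d =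
      (\<Sum>i<length ps. pmf (?R i) d * (real (length (ps ! i)) / real (Suc k)))"
  proof -
    have "pmf (riffle (Suc k) ps) d = (\<Sum>i<length ps. pmf (?R i) d * pmf (choose_pile ps) i)"
      unfolding riffle.simps pmf_bind using in_set_choose_pileD[OF ne]
      by (intro integral_measure_pmf_real) auto
    then show ?thesis using Suc.prems pmf_choose_pile[OF ne] by simp
  qed
  show ?case
  proof (cases d rule: rev_cases)
    case Nil
    have "\<not> is_riffle ps d"
      using ne Nil by (auto simp: is_riffle_def in_set_conv_nth) metis
    moreover have "pmf (?R i) d = 0" for i
      using Nil by (intro pmf_map_outside) auto
    ultimately show ?thesis by (simp only: sum) simp
  next
    case (snoc d' x)
    show ?thesis
    proof (cases "\<exists>i<length ps. ps ! i \<noteq> [] \<and> last (ps ! i) = x")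
      case True
      then obtain i where i: "i < length ps" "ps ! i \<noteq> []" "last (ps ! i) = x" by auto
      define q where "q = butlast (ps ! i)"
      have psi: "ps ! i = q @ [x]" using i(2) by (simp add: q_def flip: i(3))
      let ?qs = "ps[i := q]"
      \<comment> \<open>The piles are disjoint, so no other nonempty pile ends in \<open>x\<close>;
        an empty pile has weight 0.\<close>
      have other: "pmf (?R j) d * (real (length (ps ! j)) / real (Suc k)) = 0"
        if "j \<in> {..<length ps} - {i}" for j
      proof (cases "ps ! j = []")
        case False
        then have "last (ps ! j) \<noteq> x"
          using distinct_concat_nth_disjoint[OF Suc.prems(1), of i j] that i
          by (metis Diff_iff disjoint_iff insertI1 last_in_set lessThan_iff)
        then show ?thesis by (simp add: snoc pmf_map_snoc)
      qed simp
      have ps: "ps = take i ps @ (q @ [x]) # drop (Suc i) ps"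
        using i(1) psi by (metis id_take_nth_drop)
      have qs: "?qs = take i ps @ q # drop (Suc i) ps"
        using i(1) by (simp add: upd_conv_take_nth_drop)
      have "mset (concat ps) = add_mset x (mset (concat ?qs))"
        by (subst ps, subst qs) simp
      then have dq: "distinct (concat ?qs)"
        using Suc.prems(1) by (metis mset_eq_imp_distinct_iff mset.simps(2) distinct.simps(2))
      have lq: "length (concat ?qs) = k"
        using length_concat_update_butlast[OF i(1,2) Suc.prems(2)] by (simp add: q_def)
      have prod: "(\<Prod>p\<leftarrow>ps. fact (length p)) =
          real (length (ps ! i)) * (\<Prod>p\<leftarrow>?qs. fact (length p) :: real)"
        unfolding psi by (subst ps, subst qs) simp
      have "(\<Sum>j\<in>{..<length ps} - {i}. pmf (?R j) d * (real (length (ps ! j)) / real (Suc k))) = 0"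
        using other by (intro sum.neutral ballI)
      then have "pmf (riffle (Suc k) ps) d = pmf (?R i) d * (real (length (ps ! i)) / real (Suc k))"
        unfolding sum using i(1)
        by (simp only: sum.remove[of "{..<length ps}" i] finite_lessThan lessThan_iff add_0_right)
      also have "\<dots> = pmf (riffle k ?qs) d' * (real (length (ps ! i)) / real (Suc k))"
        using i(3) by (simp add: snoc pmf_map_snoc q_def)
      also have "\<dots> = (if is_riffle ps d then (\<Prod>p\<leftarrow>ps. fact (length p)) / fact (Suc k) else 0)"
        unfolding Suc.IH[OF dq lq] prod snoc is_riffle_snoc[OF Suc.prems(1) i(1) psi]
        by (simp add: ac_simps del: of_nat_Suc)
      finally show ?thesis .
    next
      case False
      have "pmf (?R j) d * (real (length (ps ! j)) / real (Suc k)) = 0"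
        if "j \<in> {..<length ps}" for j
        using that False by (cases "ps ! j = []") (auto simp: snoc pmf_map_snoc)
      then have "pmf (riffle (Suc k) ps) d = 0" unfolding sum by (intro sum.neutral) auto
      moreover have "\<not> is_riffle ps d"
      proof
        assume r: "is_riffle ps d"
        then have "x \<in> set (concat ps)" by (simp add: is_riffle_def snoc)
        then obtain p where "p \<in> set ps" "x \<in> set p" by auto
        then obtain j where j: "j < length ps" "x \<in> set (ps ! j)" by (metis in_set_conv_nth)
        then have "ps ! j = filter (\<lambda>y. y \<in> set (ps ! j)) d' @ [x]"
          using r by (auto simp: is_riffle_def snoc)
        with j False show False by (metis last_snoc snoc_eq_iff_butlast)
      qed
      ultimately show ?thesis by simp
    qed
  qed
qed

section \<open>Counting compatible label sequences\<close>

text \<open>For \<open>k\<close> at least 1 this counts the compatible label sequences on the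
  \<open>i + 1\<close> cards \<open>0, ..., i\<close> with last label \<open>k\<close>. The label
  before \<open>k\<close> is either smaller, or equal to \<open>k\<close> if the parity of
  \<open>k\<close> fits the step \<open>asc i\<close>.\<close>

fun compat_count :: "(nat \<Rightarrow> bool) \<Rightarrow> nat \<Rightarrow> nat \<Rightarrow> nat" where
  "compat_count asc 0 k = 1"
| "compat_count asc (Suc i) k =
     (\<Sum>l\<in>{1..<k}. compat_count asc i l) + (if even k \<longleftrightarrow> asc i then compat_count asc i k else 0)"

text \<open>The steps \<open>e\<close> and \<open>Suc e\<close> involve the cards \<open>e\<close>
  to \<open>e + 2\<close>, so the bound keeps the whole peak among the first \<open>i + 1\<close>
  cards.\<close>

definition asc_peaks :: "(nat \<Rightarrow> bool) \<Rightarrow> nat \<Rightarrow> nat" where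
  "asc_peaks asc i = card {e. Suc e < i \<and> asc e \<and> \<not> asc (Suc e)}"

section \<open>Generating functions by parity of the last label\<close>

text \<open>The zeroth coefficient must be set to 0 by hand, here and in \<open>even_gf\<close>:
  labels start at 1, but \<open>2 * j - 1\<close> truncates to 0 at \<open>j = 0\<close>, where
  \<open>compat_count asc 0 0\<close> is 1.\<close>

definition odd_gf :: "(nat \<Rightarrow> bool) \<Rightarrow> nat \<Rightarrow> real fps" where
  "odd_gf asc i = Abs_fps (\<lambda>j. if j = 0 then 0 else real (compat_count asc i (2 * j - 1)))"

definition even_gf :: "(nat \<Rightarrow> bool) \<Rightarrow> nat \<Rightarrow> real fps" where
  "even_gf asc i = Abs_fps (\<lambda>j. if j = 0 then 0 else real (compat_count asc i (2 * j)))"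

definition total_gf :: "(nat \<Rightarrow> bool) \<Rightarrow> nat \<Rightarrow> real fps" where
  "total_gf asc i = Abs_fps (\<lambda>j. real (\<Sum>l\<in>{1..2 * j}. compat_count asc i l))"

lemma asc_peaks_Suc:
  "asc_peaks asc (Suc i) = asc_peaks asc i + (if 1 \<le> i \<and> asc (i - 1) \<and> \<not> asc i then 1 else 0)"
proof (cases i)
  case 0
  then show ?thesis by (simp add: asc_peaks_def)
next
  case (Suc j)
  let ?A = "\<lambda>i. {e. Suc e < i \<and> asc e \<and> \<not> asc (Suc e)}"
  have "?A (Suc i) = ?A i \<union> (if asc j \<and> \<not> asc i then {j} else {})"
    using Suc by (auto simp: less_Suc_eq)
  moreover have "finite (?A i)" "j \<notin> ?A i"
    using Suc by (auto intro: finite_subset[of _ "{..<i}"])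
  ultimately show ?thesis using Suc by (simp add: asc_peaks_def)
qed

lemma total_gf_diff: "(1 - fps_X) * total_gf asc i = odd_gf asc i + even_gf asc i"
proof (rule fps_ext)
  fix j
  show "fps_nth ((1 - fps_X) * total_gf asc i) j = fps_nth (odd_gf asc i + even_gf asc i) j"
  proof (cases j)
    case (Suc k)
    have "{1..2 * j} = insert (2 * k + 2) (insert (2 * k + 1) {1..2 * k})"
      using Suc by auto
    then show ?thesis
      using Suc by (simp add: algebra_simps total_gf_def odd_gf_def even_gf_def fps_X_mult_nth)
  qed (simp add: algebra_simps total_gf_def odd_gf_def even_gf_def)
qed

lemma odd_gf_Suc:
  "odd_gf asc (Suc i) = fps_X * total_gf asc i + (if asc i then 0 else odd_gf asc i)"
proof (rule fps_ext)
  fix j :: nat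
  have "{1..<2 * j - 1} = {1..2 * (j - 1)}" by auto
  then show "fps_nth (odd_gf asc (Suc i)) j =
      fps_nth (fps_X * total_gf asc i + (if asc i then 0 else odd_gf asc i)) j"
    by (cases j) (auto simp: odd_gf_def total_gf_def)
qed

text \<open>Below \<open>2 * j\<close> lie the labels up to \<open>2 * (j - 1)\<close> and also the
  odd label \<open>2 * j - 1\<close> of the same index; the latter gives the extra term
  \<open>odd_gf asc i\<close> compared with the odd recurrence.\<close>

lemma even_gf_Suc:
  "even_gf asc (Suc i) = fps_X * total_gf asc i + odd_gf asc i + (if asc i then even_gf asc i else 0)"
proof (rule fps_ext)
  fix j
  show "fps_nth (even_gf asc (Suc i)) j =
      fps_nth (fps_X * total_gf asc i + odd_gf asc i + (if asc i then even_gf asc i else 0)) j"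
  proof (cases j)
    case (Suc k)
    have "{1..<2 * j} = insert (2 * k + 1) {1..2 * k}"
      using Suc by auto
    then show ?thesis using Suc by (auto simp: odd_gf_def even_gf_def total_gf_def)
  qed (auto simp: odd_gf_def even_gf_def)
qed

text \<open>The closed form of the total needs the relation between the odd and even parts left by
  the last step; it lets the next step be written in terms of the total alone. The inequalities make
  the truncated exponent exact, and the strict one supplies a factor \<open>1 + fps_X\<close> that a
  peak consumes.\<close>

lemma gf_invariant:
  "2 * asc_peaks asc i \<le> i \<and>
   (1 - fps_X) ^ (i + 2) * total_gf asc i =
     2 * fps_X * (1 + fps_X) ^ (i - 2 * asc_peaks asc i) * (4 * fps_X) ^ asc_peaks asc i \<and>
   (if 1 \<le> i \<and> asc (i - 1) then 2 * asc_peaks asc i < i \<and> odd_gf asc i = fps_X * even_gf asc i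
    else odd_gf asc i = even_gf asc i)"
proof (induction i)
  case 0
  have asc_peaks0: "asc_peaks asc 0 = 0" by (simp add: asc_peaks_def)
  have "odd_gf asc 0 + even_gf asc 0 = 2 * Abs_fps (\<lambda>j. if j = 0 then 0 else 1)"
    by (rule fps_ext) (simp add: odd_gf_def even_gf_def numeral_fps_const)
  moreover have "(1 - fps_X) * Abs_fps (\<lambda>j. if j = 0 then 0 else 1) = (fps_X :: real fps)"
    by (rule fps_ext) (auto simp: left_diff_distrib fps_X_nth)
  ultimately have "(1 - fps_X) ^ 2 * total_gf asc 0 = 2 * fps_X"
    using total_gf_diff[of asc 0] by (simp add: power2_eq_square mult.assoc mult.left_commute)
  moreover have "odd_gf asc 0 = even_gf asc 0"
    by (auto simp: odd_gf_def even_gf_def fps_eq_iff)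
  ultimately show ?case by (simp add: asc_peaks0 power2_eq_square)
next
  case (Suc i)
  let ?t = "fps_X :: real fps" and ?p = "asc_peaks asc i"
  let ?T = "total_gf asc i" and ?T' = "total_gf asc (Suc i)" and ?X = "odd_gf asc i" and ?Y = "even_gf asc i"
  from Suc have p: "2 * ?p \<le> i"
    and T: "(1 - ?t) ^ (i + 2) * ?T = 2 * ?t * (1 + ?t) ^ (i - 2 * ?p) * (4 * ?t) ^ ?p" by auto
  note T' = total_gf_diff[of asc "Suc i"] and Td = total_gf_diff[of asc i]
  \<comment> \<open>An ascent, and a descent that does not complete a peak, both multiply the total
    by \<open>(1 + ?t) / (1 - ?t)\<close>.\<close>
  have keep: "(1 - ?t) ^ (Suc i + 2) * ?T' =
      2 * ?t * (1 + ?t) ^ (Suc i - 2 * ?p) * (4 * ?t) ^ ?p"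
    if eq: "(1 - ?t) * ?T' = (1 + ?t) * ?T"
  proof -
    have "(1 - ?t) ^ (Suc i + 2) * ?T' = (1 - ?t) ^ (i + 2) * ((1 - ?t) * ?T')"
      by (simp add: algebra_simps)
    also have "\<dots> = (1 + ?t) * ((1 - ?t) ^ (i + 2) * ?T)"
      by (simp only: eq) (simp add: algebra_simps)
    finally show ?thesis
      using p by (simp only: T Suc_diff_le) (simp add: algebra_simps)
  qed
  consider (asc) "asc i" | (peak) "\<not> asc i" "1 \<le> i" "asc (i - 1)"
    | (desc) "\<not> asc i" "\<not> (1 \<le> i \<and> asc (i - 1))" by blast
  then show ?case
  proof cases
    case asc
    \<comment> \<open>Here \<open>?X + ?Y = (1 - ?t) * ?T\<close> is added to
      \<open>?t * ?T\<close>.\<close>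
    have Y': "even_gf asc (Suc i) = ?T"
      using asc Td by (simp add: even_gf_Suc algebra_simps)
    have X': "odd_gf asc (Suc i) = ?t * ?T"
      using asc by (simp add: odd_gf_Suc)
    have "(1 - ?t) * ?T' = (1 + ?t) * ?T"
      by (simp only: T' X' Y') (simp add: algebra_simps)
    from keep[OF this] show ?thesis
      using asc p X' Y' by (simp add: asc_peaks_Suc)
  next
    case desc
    then have XY: "?X = ?Y" using Suc by auto
    have "(1 - ?t) * ?T' = 2 * ?t * ?T + (?X + ?Y)"
      using desc by (simp only: T' odd_gf_Suc even_gf_Suc XY) (simp add: algebra_simps)
    also have "\<dots> = (1 + ?t) * ?T"
      by (simp only: Td[symmetric]) (simp add: algebra_simps)
    finally have "(1 - ?t) * ?T' = (1 + ?t) * ?T" .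
    moreover have "asc_peaks asc (Suc i) = ?p" using desc by (simp add: asc_peaks_Suc)
    ultimately show ?thesis
      using keep desc p by (simp add: odd_gf_Suc even_gf_Suc)
  next
    case peak
    then have XY: "?X = ?t * ?Y" and p': "2 * ?p < i" using Suc by auto
    \<comment> \<open>After an ascent \<open>?X\<close> is not half of \<open>?X + ?Y\<close>.
      Multiplying by \<open>1 + ?t\<close> turns it into \<open>?t * (?X + ?Y)\<close>, a multiple
      of the total; the factor is cancelled at the end.\<close>
    have "(1 + ?t) * ((1 - ?t) * ?T') = 2 * ?t * (1 + ?t) * ?T + 2 * ((1 + ?t) * ?X)"
      using peak by (simp only: T' odd_gf_Suc even_gf_Suc) (simp add: algebra_simps)
    also have "(1 + ?t) * ?X = ?t * (?X + ?Y)"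
      using XY by (simp add: algebra_simps)
    also have "?X + ?Y = (1 - ?t) * ?T" by (simp add: Td)
    finally have eq: "(1 + ?t) * ((1 - ?t) * ?T') = 4 * ?t * ?T"
      by (simp add: algebra_simps)
    \<comment> \<open>The strict inequality guarantees one factor \<open>1 + ?t\<close> in the
      closed form to cancel against.\<close>
    obtain e where e: "i - 2 * ?p = Suc e"
      using p' by (metis Suc_diff_Suc)
    have "(1 + ?t) * ((1 - ?t) ^ (Suc i + 2) * ?T') =
        (1 - ?t) ^ (i + 2) * ((1 + ?t) * ((1 - ?t) * ?T'))"
      by (simp add: algebra_simps)
    also have "\<dots> = 4 * ?t * ((1 - ?t) ^ (i + 2) * ?T)"
      by (simp only: eq) (simp add: algebra_simps)
    also have "\<dots> = (1 + ?t) * (2 * ?t * (1 + ?t) ^ e * (4 * ?t) ^ Suc ?p)"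
      by (simp only: T e) (simp add: algebra_simps)
    finally have "(1 + ?t) * ((1 - ?t) ^ (Suc i + 2) * ?T') =
        (1 + ?t) * (2 * ?t * (1 + ?t) ^ e * (4 * ?t) ^ Suc ?p)" .
    moreover have "1 + ?t \<noteq> 0"
      by (metis fps_X_nth fps_add_nth fps_one_nth fps_zero_nth add.right_neutral zero_neq_one)
    ultimately have "(1 - ?t) ^ (Suc i + 2) * ?T' = 2 * ?t * (1 + ?t) ^ e * (4 * ?t) ^ Suc ?p"
      by (metis mult_left_cancel)
    moreover have "Suc i - 2 * Suc ?p = e" using e by simp
    moreover have "asc_peaks asc (Suc i) = Suc ?p" using peak by (simp add: asc_peaks_Suc)
    ultimately show ?thesis
      using peak p' by (simp add: odd_gf_Suc even_gf_Suc)
  qed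
qed

section \<open>Coefficient extraction\<close>

text \<open>In the closed form of the total, \<open>a\<close> is the exponent contributed by the
  numerator \<open>t^p (1 + t)^(i - 2p)\<close> and \<open>m - 1 - a\<close> the one contributed by
  \<open>(1 - t)^(-(i + 2))\<close>; one further factor \<open>t\<close> accounts for the shift from
  \<open>m\<close> to \<open>m - 1\<close>. The constant is
  \<open>2 * 4^p = 4^(p + 1) / 2\<close>.\<close>

lemma sum_compat_count:
  assumes "1 \<le> m"
  shows "real (\<Sum>l\<in>{1..2 * m}. compat_count asc i l) = 4 ^ (asc_peaks asc i + 1) / 2 *
    (\<Sum>a = 0..m - 1. real (binom (int (Suc i) + int m - int a - 1) (int (Suc i))) *
       real (binom (int (Suc i) - 1 - 2 * int (asc_peaks asc i)) (int a - int (asc_peaks asc i))))"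
proof -
  let ?t = "fps_X :: real fps" and ?p = "asc_peaks asc i"
  \<comment> \<open>This is the expansion of \<open>(1 - ?t)^(-(i + 2))\<close>.\<close>
  define G :: "real fps" where "G = Abs_fps (\<lambda>k. of_nat ((i + 1 + k) choose k))"
  have p: "2 * ?p \<le> i"
    and T: "(1 - ?t) ^ (i + 2) * total_gf asc i = 2 * ?t * (1 + ?t) ^ (i - 2 * ?p) * (4 * ?t) ^ ?p"
    using gf_invariant[of asc i] by auto
  have G: "(1 - ?t) ^ (i + 2) * G = 1"
  proof -
    have "G = inverse ((1 - ?t) ^ (i + 2))"
      using one_minus_const_fps_X_neg_power'[of "i + 2" "1 :: real"] by (simp add: G_def)
    moreover have "fps_nth ((1 - ?t) ^ (i + 2)) 0 \<noteq> 0" by (simp add: fps_power_zeroth)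
    ultimately show ?thesis by (simp del: fps_mult_nth_0 add: inverse_mult_eq_1')
  qed
  have "total_gf asc i = total_gf asc i * ((1 - ?t) ^ (i + 2) * G)" by (simp only: G mult_1_right)
  also have "\<dots> = ((1 - ?t) ^ (i + 2) * total_gf asc i) * G" by (simp add: algebra_simps)
  also have "\<dots> = fps_const (2 * 4 ^ ?p) * (?t ^ Suc ?p * (1 + ?t) ^ (i - 2 * ?p) * G)"
    by (simp only: T)
      (simp add: power_mult_distrib numeral_fps_const fps_const_power flip: fps_const_mult)
  finally have "fps_nth (total_gf asc i) m = 2 * 4 ^ ?p * fps_nth (?t ^ Suc ?p * (1 + ?t) ^ (i - 2 * ?p) * G) m"
    by (simp del: power_Suc)
  also have "?t ^ Suc ?p * (1 + ?t) ^ (i - 2 * ?p) * G = ?t * (?t ^ ?p * (1 + ?t) ^ (i - 2 * ?p) * G)"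
    by (simp add: algebra_simps)
  also have "fps_nth \<dots> m = fps_nth (?t ^ ?p * (1 + ?t) ^ (i - 2 * ?p) * G) (m - 1)"
    using assms by simp
  also have "\<dots> = (\<Sum>a = 0..m - 1. fps_nth (?t ^ ?p * (1 + ?t) ^ (i - 2 * ?p)) a * fps_nth G (m - 1 - a))"
    by (simp add: fps_mult_nth)
  also have "\<dots> = (\<Sum>a = 0..m - 1. real (binom (int (Suc i) + int m - int a - 1) (int (Suc i))) *
       real (binom (int (Suc i) - 1 - 2 * int ?p) (int a - int ?p)))"
  proof (rule sum.cong[OF refl])
    fix a assume "a \<in> {0..m - 1}"
    then have a: "a < m" using assms by auto
    have "fps_nth (?t ^ ?p * (1 + ?t) ^ (i - 2 * ?p)) a =
        (if a < ?p then 0 else real (i - 2 * ?p choose (a - ?p)))"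
      by (simp add: fps_X_power_mult_nth binomial_gbinomial flip: fps_binomial_of_nat)
    also have "\<dots> = real (binom (int (Suc i) - 1 - 2 * int ?p) (int a - int ?p))"
    proof -
      have "nat (int i - 2 * int ?p) = i - 2 * ?p" "nat (int a - int ?p) = a - ?p" by auto
      then show ?thesis using p by (auto simp: binom_def binomial_eq_0)
    qed
    finally have 1: "fps_nth (?t ^ ?p * (1 + ?t) ^ (i - 2 * ?p)) a = \<dots>" .
    have "fps_nth G (m - 1 - a) = real (Suc i + (m - 1 - a) choose (m - 1 - a))"
      by (simp add: G_def)
    also have "Suc i + (m - 1 - a) choose (m - 1 - a) = Suc i + (m - 1 - a) choose Suc i"
      by (subst binomial_symmetric) auto
    also have "\<dots> = binom (int (Suc i) + int m - int a - 1) (int (Suc i))"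
    proof -
      have e: "nat (int (Suc i) + int m - int a - 1) = Suc i + (m - 1 - a)" using a by auto
      have b: "0 \<le> int (Suc i) \<and> int (Suc i) \<le> int (Suc i) + int m - int a - 1" using a by auto
      show ?thesis by (simp only: binom_def e nat_int if_P[OF b])
    qed
    finally show "fps_nth (?t ^ ?p * (1 + ?t) ^ (i - 2 * ?p)) a * fps_nth G (m - 1 - a) =
       real (binom (int (Suc i) + int m - int a - 1) (int (Suc i))) *
       real (binom (int (Suc i) - 1 - 2 * int ?p) (int a - int ?p))"
      using 1 by simp
  qed
  finally show ?thesis by (simp add: total_gf_def)
qed

text \<open>
  Cards are numbered from 0 here: \<open>asc c\<close> stands for an ascent of positions from card \<open>c\<close> to card
  \<open>c + 1\<close>, and \<open>s ! c\<close> is the pile, numbered from 1, of card \<open>c\<close>.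
\<close>

definition label_seqs :: "(nat \<Rightarrow> bool) \<Rightarrow> nat \<Rightarrow> nat \<Rightarrow> nat list set" where
  "label_seqs asc r n = {s. length s = n \<and> set s \<subseteq> {1..r} \<and>
     (\<forall>c. Suc c < n \<longrightarrow> s ! c < s ! Suc c \<or> s ! c = s ! Suc c \<and> (even (s ! c) \<longleftrightarrow> asc c))}"

section \<open>Enumeration of label sequences by their last label\<close>

lemma finite_label_seqs: "finite (label_seqs asc r n)"
  by (rule finite_subset[OF _ finite_lists_length_eq[of "{1..r}" n]]) (auto simp: label_seqs_def)

lemma label_seqs_nth_le_last:
  assumes "s \<in> label_seqs asc r (Suc i)" "j \<le> i"
  shows "s ! j \<le> s ! i"
  using assms(2)
proof (induction rule: inc_induct)
  case (step c)
  then have "s ! c \<le> s ! Suc c" using assms(1) by (auto simp: label_seqs_def)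
  with step show ?case by simp
qed simp

text \<open>Deleting the last label is a bijection onto the shorter sequences whose last label may
  precede \<open>k\<close>; splitting these by that label reproduces the recursion of
  \<open>compat_count\<close>.\<close>

lemma card_label_seqs_last:
  assumes "1 \<le> k" "k \<le> r"
  shows "card {s \<in> label_seqs asc r (Suc i). s ! i = k} = compat_count asc i k"
  using assms
proof (induction i arbitrary: k)
  case 0
  then have "{s \<in> label_seqs asc r (Suc 0). s ! 0 = k} = {[k]}"
    by (auto simp: label_seqs_def length_Suc_conv)
  then show ?case by simp
next
  case (Suc i)
  let ?W = "\<lambda>i k. {s \<in> label_seqs asc r (Suc i). s ! i = k}"
  let ?L = "{1..<k} \<union> (if even k \<longleftrightarrow> asc i then {k} else {})"
  have "?W (Suc i) k = (\<lambda>s. s @ [k]) ` (\<Union>l\<in>?L. ?W i l)"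
  proof (intro equalityI subsetI)
    fix s assume s: "s \<in> ?W (Suc i) k"
    then have len: "length s = Suc (Suc i)" and k: "s ! Suc i = k" by (auto simp: label_seqs_def)
    define s' where "s' = take (Suc i) s"
    have ss': "s = s' @ [k]"
      using len k by (metis s'_def take_Suc_conv_app_nth lessI take_all order_refl)
    have "s' \<in> label_seqs asc r (Suc i)"
      using s by (auto simp: label_seqs_def s'_def dest: in_set_takeD)
    moreover have "s' ! i \<in> ?L"
    proof -
      have "s ! i \<in> set s" using s by (intro nth_mem) (simp add: label_seqs_def)
      moreover have "set s \<subseteq> {1..r}" using s by (simp add: label_seqs_def)
      ultimately have "s ! i \<in> {1..r}" by blast
      moreover have "s ! i < s ! Suc i \<or> s ! i = s ! Suc i \<and> (even (s ! i) \<longleftrightarrow> asc i)"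
        using s by (auto simp: label_seqs_def)
      ultimately show ?thesis using k by (auto simp: s'_def)
    qed
    ultimately show "s \<in> (\<lambda>s. s @ [k]) ` (\<Union>l\<in>?L. ?W i l)" using ss' by auto
  next
    fix s assume "s \<in> (\<lambda>s. s @ [k]) ` (\<Union>l\<in>?L. ?W i l)"
    then obtain s' where s': "s' \<in> label_seqs asc r (Suc i)" "s' ! i \<in> ?L" and s: "s = s' @ [k]"
      by auto
    have len: "length s' = Suc i" using s' by (simp add: label_seqs_def)
    have "s ! c < s ! Suc c \<or> s ! c = s ! Suc c \<and> (even (s ! c) \<longleftrightarrow> asc c)"
      if "Suc c < Suc (Suc i)" for c
    proof (cases "c = i")
      case True
      then show ?thesis using s'(2) len by (auto simp: s nth_append split: if_splits)
    next
      case False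
      then show ?thesis using s'(1) len that by (auto simp: s nth_append label_seqs_def)
    qed
    then show "s \<in> ?W (Suc i) k"
      using s' len Suc.prems by (auto simp: label_seqs_def s nth_append)
  qed
  moreover have "inj_on (\<lambda>s. s @ [k]) A" for A by (rule inj_onI) simp
  ultimately have "card (?W (Suc i) k) = card (\<Union>l\<in>?L. ?W i l)"
    by (simp only: card_image)
  also have "\<dots> = (\<Sum>l\<in>?L. card (?W i l))"
    by (rule card_UN_disjoint) (auto intro: finite_subset[OF _ finite_label_seqs])
  also have "\<dots> = (\<Sum>l\<in>?L. compat_count asc i l)"
    using Suc.prems by (intro sum.cong refl Suc.IH) (auto split: if_splits)
  also have "\<dots> = compat_count asc (Suc i) k" by (subst sum.union_disjoint) auto
  finally show ?case .
qed

lemma card_label_seqs: "card (label_seqs asc r (Suc i)) = (\<Sum>k\<in>{1..r}. compat_count asc i k)"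
proof -
  have "s ! i \<in> {1..r}" if "s \<in> label_seqs asc r (Suc i)" for s
  proof -
    have "s ! i \<in> set s" using that by (intro nth_mem) (simp add: label_seqs_def)
    moreover have "set s \<subseteq> {1..r}" using that by (simp add: label_seqs_def)
    ultimately show ?thesis by blast
  qed
  then have "label_seqs asc r (Suc i) = (\<Union>k\<in>{1..r}. {s \<in> label_seqs asc r (Suc i). s ! i = k})" by auto
  then have "card (label_seqs asc r (Suc i)) = card (\<Union>k\<in>{1..r}. {s \<in> label_seqs asc r (Suc i). s ! i = k})"
    by (rule arg_cong)
  also have "\<dots> = (\<Sum>k\<in>{1..r}. card {s \<in> label_seqs asc r (Suc i). s ! i = k})"
    by (rule card_UN_disjoint) (auto intro: finite_subset[OF _ finite_label_seqs])
  also have "\<dots> = (\<Sum>k\<in>{1..r}. compat_count asc i k)"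
    by (intro sum.cong refl card_label_seqs_last) auto
  finally show ?thesis .
qed

section \<open>From shuffles to label sequences\<close>

lemma pmf_replicate_pmf:
  "pmf (replicate_pmf n p) xs = (if length xs = n then (\<Prod>x\<leftarrow>xs. pmf p x) else 0)"
proof (induction n arbitrary: xs)
  case (Suc n)
  have eq: "replicate_pmf (Suc n) p = map_pmf (\<lambda>(x, xs). x # xs) (pair_pmf p (replicate_pmf n p))"
    by (simp add: pair_pmf_def map_bind_pmf bind_return_pmf)
  show ?case
  proof (cases xs)
    case Nil
    then show ?thesis unfolding eq by (auto intro!: pmf_map_outside)
  next
    case (Cons y ys)
    have "inj (\<lambda>(x :: 'a, xs). x # xs)" by (auto simp: inj_def)
    from pmf_map_inj'[OF this, of "pair_pmf p (replicate_pmf n p)" "(y, ys)"] show ?thesis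
      unfolding eq Cons by (simp add: pmf_pair Suc)
  qed
qed (simp add: indicator_def)

section \<open>Piles as the level sets of a sorted labelling\<close>

lemma sorted_replicate_minE:
  assumes "sorted s" "\<forall>x\<in>set s. (a::nat) \<le> x"
  obtains s' where "s = replicate (count_list s a) a @ s'" "sorted s'" "\<forall>x\<in>set s'. Suc a \<le> x"
proof -
  have "\<exists>s'. s = replicate (count_list s a) a @ s' \<and> sorted s' \<and> (\<forall>x\<in>set s'. Suc a \<le> x)"
    using assms
  proof (induction s)
    case (Cons x s)
    show ?case
    proof (cases "x = a")
      case True
      with Cons show ?thesis by auto
    next
      case False
      with Cons.prems have "\<forall>y\<in>set (x # s). Suc a \<le> y" by auto
      moreover from this have "count_list (x # s) a = 0" by (auto simp: count_list_0_iff)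
      ultimately show ?thesis using Cons.prems(1) by auto
    qed
  qed simp
  with that show ?thesis by blast
qed

text \<open>Equal labels are contiguous in a sorted list, so cutting by label counts gives every
  card to the pile it is labelled with. The induction peels off the block of the smallest label
  \<open>a\<close>, which may be empty.\<close>

lemma cut_deck_sorted_zip:
  assumes "sorted s" "set s \<subseteq> {a..<b}" "length xs = length s"
  shows "cut_deck (map (count_list s) [a..<b]) xs =
    map (\<lambda>i. map snd (filter (\<lambda>q. fst q = i) (zip s xs))) [a..<b]"
  using assms
proof (induction "b - a" arbitrary: a s xs)
  case 0
  then show ?case by simp
next
  case (Suc k)
  then have ab: "[a..<b] = a # [Suc a..<b]" by (simp add: upt_conv_Cons)
  define j where "j = count_list s a"
  have "\<forall>x\<in>set s. a \<le> x" using Suc.prems(2) by auto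
  from sorted_replicate_minE[OF Suc.prems(1) this] obtain s' where s: "s = replicate j a @ s'" and s': "sorted s'"
    "\<forall>x\<in>set s'. Suc a \<le> x"
    unfolding j_def by metis
  have z: "zip s xs = zip (replicate j a) (take j xs) @ zip s' (drop j xs)"
    unfolding s by (simp add: zip_append1)
  have len: "length (take j xs) = j" using Suc.prems(3) by (simp add: s)
  then have zip_j: "map snd (zip (replicate j a) (take j xs)) = take j xs" by simp
  have z1: "filter (\<lambda>q. fst q = i) (zip (replicate j a) (take j xs)) =
      (if i = a then zip (replicate j a) (take j xs) else [])" for i
    by (auto simp: filter_id_conv filter_empty_conv dest: set_zip_leftD)
  have z2: "filter (\<lambda>q. fst q = a) (zip s' (drop j xs)) = []"
    using s'(2) by (fastforce simp: filter_empty_conv dest: set_zip_leftD)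
  have cnt: "map (count_list s) [Suc a..<b] = map (count_list s') [Suc a..<b]"
    unfolding s by (intro map_cong) (auto simp: count_list_0_iff)
  have "cut_deck (map (count_list s') [Suc a..<b]) (drop j xs) =
    map (\<lambda>i. map snd (filter (\<lambda>q. fst q = i) (zip s' (drop j xs)))) [Suc a..<b]"
    using Suc.hyps(2) Suc.prems s' by (intro Suc.hyps(1)) (auto simp: s)
  also have "\<dots> = map (\<lambda>i. map snd (filter (\<lambda>q. fst q = i) (zip s xs))) [Suc a..<b]"
    unfolding z by (intro map_cong) (auto simp: z1)
  finally show ?case
    unfolding ab by (simp add: cnt flip: j_def) (simp add: z z1 z2 zip_j)
qed

definition fibre :: "nat list \<Rightarrow> nat \<Rightarrow> nat list" where
  "fibre s i = filter (\<lambda>c. s ! c = i) [0..<length s]"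

lemma cut_deck_sorted:
  assumes "sorted s" "set s \<subseteq> {1..r}"
  shows "cut_deck (map (count_list s) [1..<Suc r]) (map g [0..<length s]) =
    map (\<lambda>i. map g (fibre s i)) [1..<Suc r]"
proof -
  have z: "zip s (map g [0..<length s]) = map (\<lambda>c. (s ! c, g c)) [0..<length s]"
    by (rule nth_equalityI) auto
  have "cut_deck (map (count_list s) [1..<Suc r]) (map g [0..<length s]) =
    map (\<lambda>i. map snd (filter (\<lambda>q. fst q = i) (zip s (map g [0..<length s])))) [1..<Suc r]"
    using assms by (intro cut_deck_sorted_zip) auto
  then show ?thesis by (simp only: z filter_map fibre_def) (simp add: o_def)
qed

lemma flip_odd_piles_map:
  "flip_odd_piles (map h [1..<Suc r]) =
     map (\<lambda>i. if odd i then flip_pile (h i) else h i) [1..<Suc r]"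
proof -
  have "List.enumerate 1 (map h [1..<Suc r]) = map (\<lambda>i. (i, h i)) [1..<Suc r]"
    by (rule nth_equalityI) (auto simp: nth_enumerate_eq simp del: upt_Suc)
  then show ?thesis by (simp add: flip_odd_piles_def o_def del: upt_Suc)
qed

text \<open>The piles just before riffling, with signs forgotten and cards numbered from 0.\<close>

definition turned_piles :: "nat \<Rightarrow> nat list \<Rightarrow> nat list list" where
  "turned_piles r s = map (\<lambda>i. if odd i then rev (fibre s i) else fibre s i) [1..<Suc r]"

lemma abs_flip_odd_piles_cut_deck:
  assumes "sorted s" "set s \<subseteq> {1..r}"
  shows "map (map abs) (flip_odd_piles (cut_deck (map (count_list s) [1..<Suc r]) [1..int (length s)]))
    = map (map (\<lambda>c. 1 + int c)) (turned_piles r s)"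
proof -
  have "[1..int (length s)] = map (\<lambda>c. 1 + int c) [0..<length s]"
    by (rule nth_equalityI) auto
  then show ?thesis
    unfolding turned_piles_def
    by (simp only: cut_deck_sorted[OF assms] flip_odd_piles_map map_map)
       (auto simp: flip_pile_def rev_map simp del: upt_Suc)
qed

lemma mset_turned_piles:
  assumes "set s \<subseteq> {1..r}"
  shows "mset (concat (turned_piles r s)) = mset [0..<length s]"
proof -
  have "mset (concat (turned_piles r s)) = (\<Sum>i\<leftarrow>[1..<Suc r]. mset (fibre s i))"
    unfolding turned_piles_def mset_concat map_map o_def
    by (intro arg_cong[of _ _ sum_list] map_cong) auto
  also have "\<dots> = (\<Sum>i\<in>{1..r}. mset (fibre s i))"
    by (simp only: sum_list_distinct_conv_sum_set[OF distinct_upt] set_upt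
        atLeastLessThanSuc_atLeastAtMost)
  also have "\<dots> = mset [0..<length s]"
  proof (rule multiset_eqI)
    fix c
    have "count (\<Sum>i\<in>{1..r}. mset (fibre s i)) c =
      (\<Sum>i\<in>{1..r}. if s ! c = i then count (mset [0..<length s]) c else 0)"
      by (simp add: count_sum fibre_def del: mset_upt)
    also have "\<dots> = count (mset [0..<length s]) c"
    proof (cases "c < length s")
      case True
      then have "s ! c \<in> {1..r}" using assms nth_mem by blast
      then show ?thesis by simp
    next
      case False
      then have "count (mset [0..<length s]) c = 0" by (simp add: count_eq_zero_iff)
      then show ?thesis by simp
    qed
    finally show "count (\<Sum>i\<in>{1..r}. mset (fibre s i)) c = count (mset [0..<length s]) c" .
  qed
  finally show ?thesis .
qed

lemma length_fibre: "length (fibre s i) = count_list s i"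
proof -
  have "count_list s i = length (filter ((=) i) (map (nth s) [0..<length s]))"
    by (simp only: map_nth count_list_eq_length_filter)
  also have "\<dots> = length (filter (\<lambda>c. i = s ! c) [0..<length s])"
    by (simp only: filter_map length_map o_def)
  finally show ?thesis by (simp only: fibre_def eq_commute[of i])
qed

text \<open>The multinomial count of labellings with a given sorted form. It is what cancels the
  riffle probability of a single interleaving.\<close>

lemma prod_fact_turned_piles:
  assumes "set s \<subseteq> {1..r}"
  shows "(\<Prod>p\<leftarrow>turned_piles r s. fact (length p)) * card (permutations_of_multiset (mset s)) =
    fact (length s)"
proof -
  have "(\<Prod>p\<leftarrow>turned_piles r s. fact (length p)) = (\<Prod>i\<leftarrow>[1..<Suc r]. fact (count_list s i) :: nat)"
    unfolding turned_piles_def map_map o_def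
    by (intro arg_cong[of _ _ prod_list] map_cong) (auto simp: length_fibre)
  also have "\<dots> = (\<Prod>i\<in>{1..r}. fact (count_list s i))"
    by (simp only: prod.distinct_set_conv_list[OF distinct_upt, symmetric] set_upt
        atLeastLessThanSuc_atLeastAtMost)
  also have "\<dots> = (\<Prod>i\<in>set s. fact (count_list s i))"
    using assms by (intro prod.mono_neutral_right) (auto simp: count_list_0_iff)
  finally have "(\<Prod>p\<leftarrow>turned_piles r s. fact (length p)) = (\<Prod>i\<in>set s. fact (count_list s i) :: nat)" .
  then show ?thesis
    using card_permutations_of_multiset_aux[of "mset s"] by (simp add: count_mset mult.commute)
qed

section \<open>Interleavings and monotone positions\<close>

lemma sorted_wrt_less_inj_on:
  fixes v :: "'a \<Rightarrow> 'b::linorder"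
  assumes "sorted_wrt (\<lambda>x y. v x < v y) d"
  shows "inj_on v (set d)"
proof -
  have "sorted_wrt (<) (map v d)" using assms by (simp add: sorted_wrt_map)
  then have "distinct (map v d)" by (simp add: strict_sorted_iff)
  then show ?thesis by (simp add: distinct_map)
qed

text \<open>The restriction of \<open>d\<close> to the members of \<open>p\<close> lists them by
  increasing \<open>v\<close>, and a strictly increasing list is determined by its set.\<close>

lemma filter_eq_iff_sorted_wrt:
  fixes v :: "'a \<Rightarrow> nat"
  assumes d: "sorted_wrt (\<lambda>x y. v x < v y) d" and p: "set p \<subseteq> set d"
  shows "filter (\<lambda>x. x \<in> set p) d = p \<longleftrightarrow> sorted_wrt (\<lambda>x y. v x < v y) p"
proof
  let ?f = "filter (\<lambda>x. x \<in> set p) d"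
  have f: "sorted_wrt (\<lambda>x y. v x < v y) ?f" using d by (rule sorted_wrt_filter)
  then show "sorted_wrt (\<lambda>x y. v x < v y) p" if "?f = p" using that by simp
  assume "sorted_wrt (\<lambda>x y. v x < v y) p"
  moreover have set: "set ?f = set p" using p by auto
  ultimately have "map v ?f = map v p"
    using f by (intro strict_sorted_equal) (simp_all add: sorted_wrt_map)
  moreover have "inj_on v (set ?f \<union> set p)"
    using sorted_wrt_less_inj_on[OF d] by (rule inj_on_subset) (use p in auto)
  ultimately show "?f = p" by (rule map_inj_on)
qed

lemma sorted_wrt_filter_upt:
  "sorted_wrt P (filter Q [0..<n]) \<longleftrightarrow> (\<forall>x y. x < y \<and> y < n \<and> Q x \<and> Q y \<longrightarrow> P x y)"
  by (induction n) (auto simp: sorted_wrt_append less_Suc_eq)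

text \<open>Here \<open>v\<close> is an order-preserving stand-in for the position in
  \<open>d\<close>. Each turned pile must occur in increasing position; reading odd piles backwards
  makes that a decrease along the cards.\<close>

lemma is_riffle_turned_piles:
  fixes v :: "nat \<Rightarrow> nat"
  assumes s: "sorted s" "set s \<subseteq> {1..r}" and d: "sorted_wrt (\<lambda>x y. v x < v y) d"
    and set_d: "set d = {..<length s}"
  shows "is_riffle (turned_piles r s) d \<longleftrightarrow>
    s \<in> label_seqs (\<lambda>c. v c < v (Suc c)) r (length s)"
proof -
  let ?n = "length s"
  have neq: "v x \<noteq> v y" if "x < y" "y < ?n" for x y
    using that set_d sorted_wrt_less_inj_on[OF d] by (auto dest: inj_onD)
  have sr: "s ! x \<in> {1..r}" if "x < ?n" for x using that s(2) nth_mem by blast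
  have mono: "s ! x \<le> s ! y" if "x \<le> y" "y < ?n" for x y
    using that s(1) by (simp add: sorted_nth_mono)
  have "set (concat (turned_piles r s)) = set d"
    using mset_turned_piles[OF s(2), THEN arg_cong, of set_mset] set_d by (simp add: atLeast0LessThan)
  then have "is_riffle (turned_piles r s) d \<longleftrightarrow>
      (\<forall>p\<in>set (turned_piles r s). filter (\<lambda>x. x \<in> set p) d = p)"
    by (simp add: is_riffle_def all_set_conv_all_nth)
  also have "\<dots> \<longleftrightarrow> (\<forall>p\<in>set (turned_piles r s). sorted_wrt (\<lambda>x y. v x < v y) p)"
    by (intro ball_cong refl filter_eq_iff_sorted_wrt[OF d])
       (auto simp: set_d turned_piles_def fibre_def split: if_splits)
  also have "\<dots> \<longleftrightarrow> (\<forall>i\<in>{1..r}. sorted_wrt (\<lambda>x y. v x < v y)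
      (if odd i then rev (fibre s i) else fibre s i))"
    by (simp only: turned_piles_def set_map set_upt atLeastLessThanSuc_atLeastAtMost) blast
  also have "\<dots> \<longleftrightarrow> (\<forall>i\<in>{1..r}. \<forall>x y. x < y \<and> y < ?n \<and> s ! x = i \<and> s ! y = i \<longrightarrow>
      (if odd i then v y < v x else v x < v y))"
    by (intro ball_cong refl) (auto simp: fibre_def sorted_wrt_rev sorted_wrt_filter_upt)
  also have "\<dots> \<longleftrightarrow> (\<forall>x y. x < y \<and> y < ?n \<and> s ! x = s ! y \<longrightarrow>
      (if odd (s ! x) then v y < v x else v x < v y))" (is "?A \<longleftrightarrow> ?B")
  proof
    assume A: ?A
    show ?B
    proof (intro allI impI)
      fix x y assume xy: "x < y \<and> y < ?n \<and> s ! x = s ! y"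
      then have "s ! x \<in> {1..r}" using sr by auto
      from bspec[OF A this] xy show "if odd (s ! x) then v y < v x else v x < v y" by metis
    qed
  qed metis
  \<comment> \<open>Since \<open>s\<close> is sorted, cards of one pile are consecutive, so
    comparing neighbours suffices.\<close>
  also have "\<dots> \<longleftrightarrow> (\<forall>c. Suc c < ?n \<and> s ! c = s ! Suc c \<longrightarrow>
      (if odd (s ! c) then v (Suc c) < v c else v c < v (Suc c)))" (is "?A \<longleftrightarrow> ?B")
  proof
    assume B: ?B
    show ?A
    proof (intro allI impI)
      fix x y assume "x < y \<and> y < ?n \<and> s ! x = s ! y"
      then have "Suc x \<le> y" "y < ?n" "s ! x = s ! y" by auto
      then show "if odd (s ! x) then v y < v x else v x < v y"
      proof (induction y rule: dec_induct)
        case base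
        then show ?case using B by auto
      next
        case (step y)
        \<comment> \<open>The label of \<open>y\<close> is squeezed between the equal labels of
          \<open>x\<close> and \<open>Suc y\<close>.\<close>
        then have "s ! x \<le> s ! y" "s ! y \<le> s ! Suc y"
          using mono[of x y] mono[of y "Suc y"] by simp_all
        with step.prems have e: "s ! y = s ! Suc y" "s ! x = s ! y" by auto
        with step.IH step.prems have "if odd (s ! x) then v y < v x else v x < v y" by simp
        moreover have "if odd (s ! y) then v (Suc y) < v y else v y < v (Suc y)"
          using B e step.prems by blast
        ultimately show ?case using e by (auto split: if_splits)
      qed
    qed
  qed auto
  \<comment> \<open>Neighbours have distinct positions, so a step that is not an ascent is a
    descent; sortedness excludes a drop in labels.\<close>
  also have "\<dots> \<longleftrightarrow> (\<forall>c. Suc c < ?n \<longrightarrow>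
      s ! c < s ! Suc c \<or> s ! c = s ! Suc c \<and> (even (s ! c) \<longleftrightarrow> v c < v (Suc c)))"
  proof (intro iff_allI)
    fix c
    show "(Suc c < ?n \<and> s ! c = s ! Suc c \<longrightarrow> (if odd (s ! c) then v (Suc c) < v c else v c < v (Suc c))) \<longleftrightarrow>
      (Suc c < ?n \<longrightarrow> s ! c < s ! Suc c \<or> s ! c = s ! Suc c \<and> (even (s ! c) \<longleftrightarrow> v c < v (Suc c)))"
      using mono[of c "Suc c"] neq[of c "Suc c"] by (cases "Suc c < ?n") auto
  qed
  also have "\<dots> \<longleftrightarrow> s \<in> label_seqs (\<lambda>c. v c < v (Suc c)) r ?n"
    using s(2) by (simp add: label_seqs_def)
  finally show ?thesis .
qed

lemma sorted_label_seqs: "s \<in> label_seqs asc r n \<Longrightarrow> sorted s"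
  by (auto simp: label_seqs_def sorted_iff_nth_Suc le_less)

lemma forget_signs_map_abs: "forget_signs (map abs \<sigma>) = forget_signs \<sigma>"
  by (rule ext) (auto simp: forget_signs_def)

text \<open>Covers a point \<open>x\<close> outside the support as well, where both sides are 0.
  This matters because the deck representing \<open>w\<close> need not be reachable from the given
  piles.\<close>

lemma pmf_map_inj_insert:
  assumes "inj_on f (insert x (set_pmf M))"
  shows "pmf (map_pmf f M) (f x) = pmf M x"
proof (cases "x \<in> set_pmf M")
  case True
  with assms show ?thesis by (intro pmf_map_inj) auto
next
  case False
  then have "f x \<notin> f ` set_pmf M" using assms by (auto simp: inj_on_def)
  then show ?thesis using False by (simp add: pmf_map_outside set_pmf_iff)
qed

lemma forget_signs_word:
  assumes "length d = n"
  shows "forget_signs (map (\<lambda>c. 1 + int c) d) i = (if i \<in> {1..n} then Suc (d ! (i - 1)) else i)"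
  using assms by (auto simp: forget_signs_def nat_add_distrib)

text \<open>Moving \<open>abs\<close> inside the riffle leaves piles of distinct unsigned cards, to
  which the uniform law applies. Only one unsigned deck represents \<open>w\<close>, and in it card
  \<open>c\<close> has position \<open>inv w (Suc c)\<close>.\<close>

lemma pmf_forget_signs_riffle:
  assumes w: "w permutes {1..n}" and s: "s \<in> lists {1..r}" "length s = n" "sorted s"
  shows "pmf (map_pmf forget_signs (riffle n (flip_odd_piles
      (cut_deck (map (count_list s) [1..<Suc r]) [1..int n])))) w =
    (if s \<in> label_seqs (\<lambda>c. inv w (Suc c) < inv w (Suc (Suc c))) r n
     then (\<Prod>p\<leftarrow>turned_piles r s. fact (length p)) / fact n else 0)"
proof -
  define g where "g = (\<lambda>c. 1 + int c)"
  \<comment> \<open>The unsigned deck of \<open>w\<close>, with list indices and cards both shifted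
    to start at 0; \<open>g\<close> undoes the shift of the cards.\<close>
  define d where "d = map (\<lambda>c. w (Suc c) - 1) [0..<n]"
  define f where "f = (\<lambda>d. forget_signs (map g d))"
  let ?ps = "flip_odd_piles (cut_deck (map (count_list s) [1..<Suc r]) [1..int n])"
  let ?M = "riffle n (turned_piles r s)"
  have sr: "set s \<subseteq> {1..r}" using s(1) by auto
  have mset: "mset (concat (turned_piles r s)) = mset [0..<n]"
    using mset_turned_piles[OF sr] s(2) by simp
  then have len: "length (concat (turned_piles r s)) = n"
    by (metis size_mset length_upt diff_zero)
  have dist: "distinct (concat (turned_piles r s))"
    using mset by (metis mset_eq_imp_distinct_iff distinct_upt)
  have abs: "map (map abs) ?ps = map (map g) (turned_piles r s)"
    using abs_flip_odd_piles_cut_deck[OF s(3) sr] s(2) by (simp only: g_def)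
  have "length (concat ?ps) = length (concat (map (map abs) ?ps))"
    by (simp add: length_concat o_def)
  also have "\<dots> = n"
    unfolding abs using len by (simp add: length_concat o_def)
  finally have len': "length (concat ?ps) = n" .
  have "map_pmf forget_signs (riffle n ?ps) = map_pmf forget_signs (map_pmf (map abs) (riffle n ?ps))"
    by (simp add: pmf.map_comp o_def forget_signs_map_abs)
  also have "\<dots> = map_pmf f ?M"
    unfolding map_riffle[OF len'] abs map_riffle[OF len, symmetric]
    by (simp add: pmf.map_comp o_def f_def)
  finally have map_eq: "map_pmf forget_signs (riffle n ?ps) = map_pmf f ?M" .

  have lenM: "length e = n" if "e \<in> insert d (set_pmf ?M)" for e
    using that len mset_eq_length[OF mset_riffle[OF _ len]] by (auto simp: d_def)
  have inj: "inj_on f (insert d (set_pmf ?M))"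
  proof (rule inj_onI)
    fix x y assume xy: "x \<in> insert d (set_pmf ?M)" "y \<in> insert d (set_pmf ?M)" "f x = f y"
    note lens = lenM[OF xy(1)] lenM[OF xy(2)]
    show "x = y"
    proof (rule nth_equalityI)
      fix i assume "i < length x"
      then show "x ! i = y ! i"
        using fun_cong[OF xy(3), of "Suc i"] lens by (simp add: f_def g_def forget_signs_word)
    qed (simp add: lens)
  qed
  have wpos: "w (Suc c) \<in> {1..n}" if "c < n" for c
    using permutes_in_image[OF w, of "Suc c"] that by simp
  have "f d = w"
  proof
    fix i
    have "f d i = (if i \<in> {1..n} then Suc (d ! (i - 1)) else i)"
      unfolding f_def g_def by (rule forget_signs_word) (simp add: d_def)
    also have "\<dots> = w i"
    proof (cases "i \<in> {1..n}")
      case True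
      then obtain c where "i = Suc c" "c < n" by (cases i) auto
      then show ?thesis using wpos[of c] by (simp add: d_def)
    next
      case False
      then show ?thesis using permutes_not_in[OF w, of i] by auto
    qed
    finally show "f d i = w i" .
  qed
  with pmf_map_inj_insert[OF inj] have "pmf (map_pmf f ?M) w = pmf ?M d" by simp
  also have "\<dots> = (if is_riffle (turned_piles r s) d
      then (\<Prod>p\<leftarrow>turned_piles r s. fact (length p)) / fact n else 0)"
    by (rule pmf_riffle[OF dist len])
  also have "is_riffle (turned_piles r s) d \<longleftrightarrow>
      s \<in> label_seqs (\<lambda>c. inv w (Suc c) < inv w (Suc (Suc c))) r n"
  proof -
    have inv_d: "inv w (Suc (d ! c)) = Suc c" if "c < n" for c
      using wpos[OF that] that permutes_inverses(2)[OF w] by (simp add: d_def)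
    have "sorted_wrt (\<lambda>x y. inv w (Suc x) < inv w (Suc y)) d"
      by (auto simp: sorted_wrt_iff_nth_less inv_d d_def[THEN arg_cong, of length])
    moreover have "set d = {..<length s}"
    proof (rule card_subset_eq)
      have "distinct d"
        unfolding distinct_conv_nth using inv_d
        by (metis Suc_inject d_def diff_zero length_map length_upt)
      then have "card (set d) = length d" by (rule distinct_card)
      then show "card (set d) = card {..<length s}" using s(2) by (simp add: d_def)
      show "set d \<subseteq> {..<length s}" using wpos s(2) by (force simp: d_def)
    qed simp
    ultimately show ?thesis
      using is_riffle_turned_piles[OF s(3) sr, of "\<lambda>c. inv w (Suc c)" d] s(2) by simp
  qed
  finally show ?thesis unfolding map_eq .
qed

section \<open>Averaging over all labellings\<close>

text \<open>All labellings are equally likely, and the piles depend only on the label counts, hence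
  on \<open>sort ls\<close>. Grouping labellings by their sorted form, the size of each group
  cancels the riffle probability, so every compatible sorted form contributes exactly 1.\<close>

lemma pmf_shuffle_eq_card_label_seqs:
  assumes w: "w permutes {1..n}" and m: "m \<ge> 1"
  shows "pmf (map_pmf forget_signs (hyperoctahedral_shuffle m n)) w =
    card (label_seqs (\<lambda>c. inv w (Suc c) < inv w (Suc (Suc c))) (2 * m) n) / (2 * real m) ^ n"
proof -
  define r where "r = 2 * m"
  let ?V = "label_seqs (\<lambda>c. inv w (Suc c) < inv w (Suc (Suc c))) r n"
  let ?R = "replicate_pmf n (pmf_of_set {1..r})"
  let ?K = "\<lambda>ls. map_pmf forget_signs (riffle n (flip_odd_piles
      (cut_deck (map (count_list ls) [1..<Suc r]) [1..int n])))"
  define L where "L = {ls \<in> lists {1..r}. length ls = n}"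
  define h where "h s = (if s \<in> ?V
      then (\<Prod>p\<leftarrow>turned_piles r s. fact (length p)) / fact n else (0 :: real))" for s
  have L_finite: "finite L"
    unfolding L_def lists_eq_set using finite_lists_length_eq[of "{1..r}" n] by simp
  have r: "{1..r} \<noteq> {}" using m by (simp add: r_def)
  have K: "pmf (?K ls) w = h (sort ls)" if "ls \<in> L" for ls
  proof -
    have "count_list ls = count_list (sort ls)"
      by (rule ext) (metis count_mset mset_sort)
    moreover have "sort ls \<in> lists {1..r}" "length (sort ls) = n" "sorted (sort ls)"
      using that by (auto simp: L_def)
    ultimately show ?thesis
      unfolding h_def by (simp only: pmf_forget_signs_riffle[OF w])
  qed
  have R: "pmf ?R ls = 1 / real r ^ n" if "ls \<in> L" for ls
  proof -
    have "map (pmf (pmf_of_set {1..r})) ls = replicate n (1 / real r)"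
      using that r by (intro replicate_eqI) (auto simp: L_def)
    then show ?thesis using that by (simp add: pmf_replicate_pmf L_def power_divide)
  qed
  have "map_pmf forget_signs (hyperoctahedral_shuffle m n) = bind_pmf ?R ?K"
    unfolding hyperoctahedral_shuffle_def pile_sizes_def r_def
    by (simp only: map_bind_pmf bind_map_pmf)
  then have "pmf (map_pmf forget_signs (hyperoctahedral_shuffle m n)) w = pmf (bind_pmf ?R ?K) w"
    by (rule arg_cong)
  also have "\<dots> = (\<Sum>ls\<in>L. pmf (?K ls) w * pmf ?R ls)"
    unfolding pmf_bind
    by (intro integral_measure_pmf_real L_finite) (use r in \<open>auto simp: set_replicate_pmf L_def\<close>)
  also have "\<dots> = (\<Sum>ls\<in>L. h (sort ls)) / real r ^ n"
    unfolding sum_divide_distrib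
    by (intro sum.cong refl) (simp only: K R times_divide_eq_right mult_1_right)
  also have "(\<Sum>ls\<in>L. h (sort ls)) = (\<Sum>s\<in>sort ` L. \<Sum>ls\<in>{ls \<in> L. sort ls = s}. h (sort ls))"
    by (rule sum.image_gen[OF L_finite])
  also have "\<dots> = (\<Sum>s\<in>sort ` L. if s \<in> ?V then 1 else 0)"
  proof (rule sum.cong[OF refl])
    fix s assume "s \<in> sort ` L"
    then have s: "set s \<subseteq> {1..r}" "length s = n" "sorted s" by (auto simp: L_def)
    have "{ls \<in> L. sort ls = s} = permutations_of_multiset (mset s)"
    proof (intro equalityI subsetI)
      fix ls assume "ls \<in> permutations_of_multiset (mset s)"
      then have ls: "mset ls = mset s" by (simp add: permutations_of_multiset_def)
      then have "sort ls = s" using s(3) by (simp add: properties_for_sort)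
      moreover have "ls \<in> L"
        using s mset_eq_setD[OF ls] mset_eq_length[OF ls] by (auto simp: L_def)
      ultimately show "ls \<in> {ls \<in> L. sort ls = s}" by simp
    qed (auto simp: permutations_of_multiset_def)
    moreover have "(\<Sum>ls\<in>{ls \<in> L. sort ls = s}. h (sort ls)) = (\<Sum>ls\<in>{ls \<in> L. sort ls = s}. h s)"
      by (intro sum.cong refl) auto
    ultimately have "(\<Sum>ls\<in>{ls \<in> L. sort ls = s}. h (sort ls)) =
        card (permutations_of_multiset (mset s)) * h s" by simp
    also have "\<dots> = (if s \<in> ?V then 1 else 0)"
    proof -
      have "real ((\<Prod>p\<leftarrow>turned_piles r s. fact (length p)) * card (permutations_of_multiset (mset s)))
          = real (fact (length s))"
        by (simp only: prod_fact_turned_piles[OF s(1)])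
      moreover have "real (\<Prod>p\<leftarrow>ps. fact (length p)) = (\<Prod>p\<leftarrow>ps. fact (length p))" for ps :: "nat list list"
        by (induction ps) auto
      ultimately show ?thesis using s(2) by (simp add: h_def mult.commute)
    qed
    finally show "(\<Sum>ls\<in>{ls \<in> L. sort ls = s}. h (sort ls)) = (if s \<in> ?V then 1 else 0)" .
  qed
  also have "\<dots> = card ?V"
  proof -
    \<comment> \<open>Compatible sequences are weakly increasing, so each is its own sorted
      representative and none is missed.\<close>
    have "s \<in> sort ` L" if "s \<in> ?V" for s
    proof (rule image_eqI)
      show "s = sort s" using sorted_label_seqs[OF that] by (simp add: sorted_sort_id)
      show "s \<in> L" using that by (auto simp: L_def label_seqs_def)
    qed
    then have "sort ` L \<inter> ?V = ?V" by auto
    then show ?thesis using L_finite by (simp add: sum.If_cases Collect_mem_eq)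
  qed
  finally show ?thesis by (simp add: r_def)
qed

text \<open>A peak at index \<open>k\<close> corresponds to the ascent step
  \<open>e = k - 2\<close>, cards being counted from 0 on the right; injectivity makes a step that
  is not an ascent a strict descent.\<close>

lemma num_peaks_eq_asc_peaks:
  assumes "inj u"
  shows "num_peaks (Suc i) u = asc_peaks (\<lambda>c. u (Suc c) < u (Suc (Suc c))) i"
proof -
  have "{k. 1 < k \<and> k < Suc i \<and> u (k - 1) < u k \<and> u k > u (k + 1)} =
    (\<lambda>e. Suc (Suc e)) ` {e. Suc e < i \<and> u (Suc e) < u (Suc (Suc e)) \<and>
      \<not> u (Suc (Suc e)) < u (Suc (Suc (Suc e)))}" (is "?A = _ ` ?B")
  proof (intro equalityI subsetI)
    fix k assume k: "k \<in> ?A"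
    then obtain e where "k = Suc (Suc e)" by (auto simp: less_iff_Suc_add)
    with k show "k \<in> (\<lambda>e. Suc (Suc e)) ` ?B" by auto
  next
    fix k assume "k \<in> (\<lambda>e. Suc (Suc e)) ` ?B"
    then obtain e where e: "k = Suc (Suc e)" "e \<in> ?B" by auto
    moreover have "u (Suc (Suc e)) \<noteq> u (Suc (Suc (Suc e)))" using assms by (simp add: inj_eq)
    ultimately show "k \<in> ?A" by auto
  qed
  then show ?thesis by (simp add: num_peaks_def asc_peaks_def card_image inj_on_def)
qed

theorem theorem3p3:
  fixes n m :: nat and w :: "nat \<Rightarrow> nat"
  assumes "n \<ge> 1" and "m \<ge> 1"
    and "w permutes {1..n}"
  shows "pmf (map_pmf forget_signs (hyperoctahedral_shuffle m n)) w =
    4 ^ (num_peaks n (inv w) + 1) / (2 * (2 * real m) ^ n) *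
    (\<Sum>a = 0..m - 1.
       real (binom (int n + int m - int a - 1) (int n)) *
       real (binom (int n - 1 - 2 * int (num_peaks n (inv w)))
                   (int a - int (num_peaks n (inv w)))))"
proof -
  obtain i where n: "n = Suc i" using assms(1) by (cases n) auto
  have "inj (inv w)" using permutes_inj[OF permutes_inv[OF assms(3)]] .
  then have "num_peaks n (inv w) = asc_peaks (\<lambda>c. inv w (Suc c) < inv w (Suc (Suc c))) i"
    unfolding n by (rule num_peaks_eq_asc_peaks)
  then show ?thesis
    unfolding pmf_shuffle_eq_card_label_seqs[OF assms(3,2)]
    unfolding n card_label_seqs sum_compat_count[OF assms(2)] by simp
qed

end
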